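(* Let $\Gamma=\{1324,123\}$. Then $\mathrm{NM}_\Gamma(t,x,y)=\left(\frac{1}{U_\Gamma(t,y)}\right)^x$ where $$U_\Gamma(t,y)=1+\sum_{n\ge1}\frac{t^{2n}}{(2n)!}\sum_{k=0}^n\frac{(2k+1)\binom{2n}{n-k}}{n+k+1}(-y)^{n+k}+\sum_{n\ge0}\frac{t^{2n+1}}{(2n+1)!}\sum_{k=0}^n\frac{2(k+1)\binom{2n+1}{n-k}}{n+k+2}(-y)^{n+k+1}.$$
   Context: For $\sigma\in\mathfrak S_n$, $\mathrm{des}(\sigma)$ is the number of $i$ with $\sigma_i>\sigma_{i+1}$; $\sigma_j$ is a left-to-right minimum if $\sigma_j<\sigma_i$ for all $i<j$, and $\mathrm{LRmin}(\sigma)$ is their number. For distinct integers $\alpha=\alpha_1\cdots\alpha_r$, $\mathrm{red}(\alpha)\in\mathfrak S_r$ replaces the $i$-th smallest entry by $i$. $\sigma$ has a $\Gamma$-match starting at position $i$ if there is $j\ge1$ with $\mathrm{red}(\sigma_i\cdots\sigma_{i+j})\in\Gamma$; $\mathcal{NM}_n(\Gamma)$ is the set of $\sigma\in\mathfrak S_n$ with no $\Gamma$-match. $\mathrm{NM}_\Gamma(t,x,y)=1+\sum_{n\ge1}\frac{t^n}{n!}\sum_{\sigma\in\mathcal{NM}_n(\Gamma)}x^{\mathrm{LRmin}(\sigma)}y^{1+\mathrm{des}(\sigma)}$. *)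

theory Defs
  imports
    "HOL-Combinatorics.Multiset_Permutations"
    "HOL-Computational_Algebra.Computational_Algebra"
begin

text \<open>
  A permutation of $\{1,\dots,n\}$ is its one-line word, i.e. an element of
  \<^term>\<open>permutations_of_set {1..n}\<close>.  List positions count from 0.
\<close>

definition des :: "'a::linorder list \<Rightarrow> nat" where
  "des \<sigma> = card {i. i + 1 < length \<sigma> \<and> \<sigma> ! i > \<sigma> ! (i + 1)}"

definition LRmin :: "'a::linorder list \<Rightarrow> nat" where
  "LRmin \<sigma> = card {j. j < length \<sigma> \<and> (\<forall>i<j. \<sigma> ! j < \<sigma> ! i)}"

definition red :: "'a::linorder list \<Rightarrow> nat list" where
  "red \<alpha> = map (\<lambda>a. card {b \<in> set \<alpha>. b \<le> a}) \<alpha>"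

definition match_at :: "nat list set \<Rightarrow> 'a::linorder list \<Rightarrow> nat \<Rightarrow> bool" where
  "match_at \<Gamma> \<sigma> i \<longleftrightarrow> (\<exists>j\<ge>1. i + j < length \<sigma> \<and> red (take (j + 1) (drop i \<sigma>)) \<in> \<Gamma>)"

definition NM_perms :: "nat list set \<Rightarrow> nat \<Rightarrow> nat list set" where
  "NM_perms \<Gamma> n = {\<sigma> \<in> permutations_of_set {1..n}. \<nexists>i. match_at \<Gamma> \<sigma> i}"

text \<open>
  The series in $t$.  The variables $x$, $y$ range over an arbitrary field of characteristic 0;
  the instance \<^typ>\<open>rat poly poly fract\<close> makes them indeterminates.
\<close>

definition NM :: "nat list set \<Rightarrow> 'a::field_char_0 \<Rightarrow> 'a \<Rightarrow> 'a fps" where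
  "NM \<Gamma> x y = 1 + Abs_fps (\<lambda>n. if n \<ge> 1
     then (\<Sum>\<sigma>\<in>NM_perms \<Gamma> n. x ^ LRmin \<sigma> * y ^ (1 + des \<sigma>)) / fact n else 0)"

text \<open>
  For $F$ with constant term 1, $F^c = \exp (c \log F)$; note that \<^term>\<open>fps_ln 1\<close> is the series
  of $\log (1 + X)$ and \<^term>\<open>fps_exp 1\<close> that of $\exp X$.
\<close>

definition fps_gpower :: "'a::field_char_0 fps \<Rightarrow> 'a \<Rightarrow> 'a fps" where
  "fps_gpower F c = fps_exp 1 oo (fps_const c * (fps_ln 1 oo (F - 1)))"

text \<open>The coefficient of $t^m$ with $m = 2n$, $n \ge 1$, respectively $m = 2n + 1$, $n \ge 0$.\<close>

definition U_even :: "'a::field_char_0 \<Rightarrow> 'a fps" where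
  "U_even y = Abs_fps (\<lambda>m. if even m \<and> m \<ge> 2 then
     (let n = m div 2 in
       (\<Sum>k=0..n. of_nat ((2 * k + 1) * ((2 * n) choose (n - k))) / of_nat (n + k + 1)
                  * (- y) ^ (n + k)) / fact (2 * n)) else 0)"

definition U_odd :: "'a::field_char_0 \<Rightarrow> 'a fps" where
  "U_odd y = Abs_fps (\<lambda>m. if odd m then
     (let n = m div 2 in
       (\<Sum>k=0..n. of_nat (2 * (k + 1) * ((2 * n + 1) choose (n - k))) / of_nat (n + k + 2)
                  * (- y) ^ (n + k + 1)) / fact (2 * n + 1)) else 0)"

definition U :: "'a::field_char_0 \<Rightarrow> 'a fps" where
  "U y = 1 + U_even y + U_odd y"

end

theory Submission
  imports Defs
begin

text \<open>
  Cutting a permutation \<open>\<alpha> m \<beta>\<close> at its minimum \<open>m\<close> shows that the series $P$ of the theorem satisfies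
  $P' = x B P$ with $B$ independent of $x$, because both patterns start with their minimum; so it
  suffices to treat $x = 1$.

  The ascending runs of an avoider have length at most two, and avoidance only says that
  no two consecutive runs $(a, b)$, $(c, d)$ satisfy $a < c$ and $b < d$ (with $a = b$ for a run of
  length one).  By the sign-reversing involution that moves one run between two adjacent sequences,
  the reciprocal of the series at $x = 1$ enumerates, with weight $-y$ per run, the sequences in which
  all consecutive runs do satisfy this.  Reading the letters in increasing order,
  such a sequence is a ballot path, which yields the ballot numbers in $U$.
\<close>

subsection \<open>Exponential convolution over subsets\<close>

lemma sum_Pow_card:
  fixes f :: "nat \<Rightarrow> nat \<Rightarrow> 'b::semiring_1"
  assumes "finite V"
  shows "(\<Sum>T\<in>Pow V. f (card T) (card (V - T))) =
         (\<Sum>k\<le>card V. of_nat (card V choose k) * f k (card V - k))"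
proof -
  have "(\<Sum>T\<in>Pow V. f (card T) (card (V - T))) = (\<Sum>T\<in>Pow V. f (card T) (card V - card T))"
    using assms by (intro sum.cong) (auto simp: card_Diff_subset finite_subset)
  also have "\<dots> = (\<Sum>k\<le>card V. \<Sum>T\<in>{T\<in>Pow V. card T = k}. f (card T) (card V - card T))"
    using assms by (intro sum.group[symmetric]) (auto intro: card_mono)
  also have "\<dots> = (\<Sum>k\<le>card V. of_nat (card V choose k) * f k (card V - k))"
    using n_subsets[OF assms] by (intro sum.cong) auto
  finally show ?thesis .
qed

text \<open>With \<open>fact n * A $ n\<close> read as the weight of an n-set, splitting
  \<open>V\<close> into an ordered pair of blocks multiplies exponential generating
  functions.\<close>

lemma egf_mult:
  fixes A B :: "'a::field_char_0 fps"
  assumes "finite V"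
  shows "(\<Sum>T\<in>Pow V. (fact (card T) * A $ card T) * (fact (card (V - T)) * B $ card (V - T))) =
         fact (card V) * (A * B) $ card V"
proof -
  have "(\<Sum>T\<in>Pow V. (fact (card T) * A $ card T) * (fact (card (V - T)) * B $ card (V - T))) =
     (\<Sum>k\<le>card V. of_nat (card V choose k) *
        ((fact k * A $ k) * (fact (card V - k) * B $ (card V - k))))"
    by (rule sum_Pow_card[OF assms, where f = "\<lambda>i j. (fact i * A $ i) * (fact j * B $ j)"])
  also have "\<dots> = (\<Sum>k\<le>card V. fact (card V) * (A $ k * B $ (card V - k)))"
    by (intro sum.cong) (auto simp: binomial_fact)
  also have "\<dots> = fact (card V) * (A * B) $ card V"
    by (simp add: fps_mult_nth sum_distrib_left atMost_atLeast0)
  finally show ?thesis .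
qed

text \<open>The convolution determines \<open>G\<close> recursively: its term at
  \<open>T = X\<close> carries the nonzero factor \<open>A $ 0\<close>, and all other terms concern
  proper subsets. In particular \<open>G\<close> depends on cardinalities only, although nothing
  about its form is assumed.\<close>

lemma egf_quotient:
  fixes A C D :: "'a::field_char_0 fps"
  assumes "finite X" and "A $ 0 \<noteq> 0" and CDA: "C = D * A"
    and conv: "\<And>V. V \<subseteq> X \<Longrightarrow>
      (\<Sum>T\<in>Pow V. G T * (fact (card (V - T)) * A $ card (V - T))) = fact (card V) * C $ card V"
  shows "G X = fact (card X) * D $ card X"
  using \<open>finite X\<close> conv
proof (induction X rule: finite_psubset_induct)
  case (psubset X)
  let ?D = "\<lambda>T. fact (card T) * D $ card T" and ?A = "\<lambda>T. fact (card (X - T)) * A $ card (X - T)"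
  have split: "sum f (Pow X) = f X + sum f (Pow X - {X})" for f :: "'b set \<Rightarrow> 'a"
    using psubset.hyps by (intro sum.remove) auto
  have "(\<Sum>T\<in>Pow X. G T * ?A T) = (\<Sum>T\<in>Pow X. ?D T * ?A T)"
    using psubset.prems[of X] egf_mult[OF psubset.hyps, of D A] CDA by simp
  moreover have "(\<Sum>T\<in>Pow X - {X}. G T * ?A T) = (\<Sum>T\<in>Pow X - {X}. ?D T * ?A T)"
  proof (intro sum.cong refl)
    fix T assume "T \<in> Pow X - {X}"
    hence "T \<subset> X" by auto
    thus "G T * ?A T = ?D T * ?A T" using psubset.IH[of T] psubset.prems by auto
  qed
  ultimately have "G X * ?A X = ?D X * ?A X"
    unfolding split by simp
  thus ?case using \<open>A $ 0 \<noteq> 0\<close> by simp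
qed

subsection \<open>Pattern avoidance as a local condition\<close>

abbreviation \<Gamma>\<^sub>0 :: "nat list set" where
  "\<Gamma>\<^sub>0 \<equiv> {[1, 3, 2, 4], [1, 2, 3]}"

definition avoids :: "'a::linorder list \<Rightarrow> bool" where
  "avoids \<sigma> \<longleftrightarrow> (\<nexists>i. match_at \<Gamma>\<^sub>0 \<sigma> i)"

text \<open>The two patterns at the front of a word, as inequalities; three letters have room for
  123 only.\<close>

fun head_match :: "'a::linorder list \<Rightarrow> bool" where
  "head_match (a # b # c # d # r) \<longleftrightarrow> a < b \<and> b < c \<or> a < c \<and> c < b \<and> b < d"
| "head_match [a, b, c] \<longleftrightarrow> a < b \<and> b < c"
| "head_match _ \<longleftrightarrow> False"

lemma length_red [simp]: "length (red \<alpha>) = length \<alpha>"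
  by (simp add: red_def)

lemma red_less_imp_less:
  assumes "card {b \<in> set \<alpha>. b \<le> u} < card {b \<in> set \<alpha>. b \<le> v}"
  shows "u < (v :: 'a::linorder)"
proof (rule ccontr)
  assume "\<not> u < v"
  hence "{b \<in> set \<alpha>. b \<le> v} \<subseteq> {b \<in> set \<alpha>. b \<le> u}" by auto
  hence "card {b \<in> set \<alpha>. b \<le> v} \<le> card {b \<in> set \<alpha>. b \<le> u}" by (intro card_mono) auto
  with assms show False by simp
qed

lemma red_eq_123_iff: "red [a, b, c] = [1, 2, 3] \<longleftrightarrow> a < b \<and> b < (c :: 'a::linorder)"
proof
  assume *: "red [a, b, c] = [1, 2, 3]"
  show "a < b \<and> b < c"
    using * by (auto simp: red_def intro!: red_less_imp_less[of "[a, b, c]"])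
next
  assume *: "a < b \<and> b < c"
  hence "{x \<in> {a, b, c}. x \<le> a} = {a}" "{x \<in> {a, b, c}. x \<le> b} = {a, b}"
    "{x \<in> {a, b, c}. x \<le> c} = {a, b, c}" by auto
  with * show "red [a, b, c] = [1, 2, 3]" by (auto simp: red_def)
qed

lemma red_eq_1324_iff:
  "red [a, b, c, d] = [1, 3, 2, 4] \<longleftrightarrow> a < c \<and> c < b \<and> b < (d :: 'a::linorder)"
proof
  assume *: "red [a, b, c, d] = [1, 3, 2, 4]"
  show "a < c \<and> c < b \<and> b < d"
    using * by (auto simp: red_def intro!: red_less_imp_less[of "[a, b, c, d]"])
next
  assume *: "a < c \<and> c < b \<and> b < d"
  hence "{x \<in> {a, b, c, d}. x \<le> a} = {a}" "{x \<in> {a, b, c, d}. x \<le> c} = {a, c}"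
    "{x \<in> {a, b, c, d}. x \<le> b} = {a, b, c}" "{x \<in> {a, b, c, d}. x \<le> d} = {a, b, c, d}" by auto
  moreover have "a \<noteq> b" "a \<noteq> c" "a \<noteq> d" "b \<noteq> c" "b \<noteq> d" "c \<noteq> d" using * by auto
  ultimately show "red [a, b, c, d] = [1, 3, 2, 4]" by (simp add: red_def)
qed

lemma match_at_0_iff: "match_at \<Gamma>\<^sub>0 \<sigma> 0 \<longleftrightarrow> head_match \<sigma>"
proof -
  have "match_at \<Gamma>\<^sub>0 \<sigma> 0 \<longleftrightarrow>
    (2 < length \<sigma> \<and> red (take 3 \<sigma>) = [1, 2, 3]) \<or> (3 < length \<sigma> \<and> red (take 4 \<sigma>) = [1, 3, 2, 4])"
    (is "_ \<longleftrightarrow> ?R")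
  proof
    assume "match_at \<Gamma>\<^sub>0 \<sigma> 0"
    then obtain j where j: "j < length \<sigma>" "red (take (j + 1) \<sigma>) \<in> \<Gamma>\<^sub>0"
      by (auto simp: match_at_def)
    have len: "length (red (take (j + 1) \<sigma>)) = j + 1" using j(1) by simp
    from j(2) have "red (take (j + 1) \<sigma>) = [1, 3, 2, 4] \<or> red (take (j + 1) \<sigma>) = [1, 2, 3]" by simp
    \<comment> \<open>Reduction preserves length, so the pattern fixes \<open>j\<close>.\<close>
    hence "j = 2 \<and> red (take (j + 1) \<sigma>) = [1, 2, 3] \<or> j = 3 \<and> red (take (j + 1) \<sigma>) = [1, 3, 2, 4]"
      using len by (elim disjE) (simp_all only: list.size, simp_all)
    with j(1) show ?R by auto
  next
    assume ?R
    thus "match_at \<Gamma>\<^sub>0 \<sigma> 0"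
      unfolding match_at_def by (auto intro: exI[of _ 2] exI[of _ 3])
  qed
  also have "\<dots> \<longleftrightarrow> head_match \<sigma>"
    by (cases \<sigma> rule: head_match.cases)
       (auto simp: red_eq_123_iff[unfolded One_nat_def] red_eq_1324_iff[unfolded One_nat_def])
  finally show ?thesis .
qed

lemma avoids_Nil [simp]: "avoids []"
  by (simp add: avoids_def match_at_def)

lemma avoids_Cons: "avoids (a # \<sigma>) \<longleftrightarrow> \<not> head_match (a # \<sigma>) \<and> avoids \<sigma>"
proof -
  have "match_at \<Gamma> (a # \<sigma>) (Suc i) \<longleftrightarrow> match_at \<Gamma> \<sigma> i" for \<Gamma> i
    by (simp add: match_at_def)
  thus ?thesis
    unfolding avoids_def match_at_0_iff[symmetric] by (metis not0_implies_Suc)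
qed

text \<open>The first letter of either pattern is its least, so a match starting in \<alpha> cannot
  reach the smaller letter \<open>m\<close>.\<close>

lemma head_match_append:
  assumes "\<forall>a\<in>set \<alpha>. m < a" "\<alpha> \<noteq> []"
  shows "head_match (\<alpha> @ m # \<beta>) \<longleftrightarrow> head_match \<alpha>"
  using assms by (cases \<alpha> rule: head_match.cases; cases \<beta>; cases "tl \<beta>") auto

lemma avoids_append_min:
  assumes "\<forall>a\<in>set \<alpha>. m < a"
  shows "avoids (\<alpha> @ m # \<beta>) \<longleftrightarrow> avoids \<alpha> \<and> avoids (m # \<beta>)"
  using assms
proof (induction \<alpha>)
  case (Cons a \<alpha>)
  thus ?case using head_match_append[of "a # \<alpha>" m \<beta>] avoids_Cons[of a "\<alpha> @ m # \<beta>"]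
    by (auto simp: avoids_Cons[of a \<alpha>])
qed simp

subsection \<open>Descents and left-to-right minima\<close>

lemma des_Nil [simp]: "des [] = 0" and des_single [simp]: "des [a] = 0"
  by (simp_all add: des_def)

lemma des_Cons_Cons [simp]: "des (a # b # r) = of_bool (a > b) + des (b # r)"
proof -
  have "{i. i + 1 < length (a # b # r) \<and> (a # b # r) ! i > (a # b # r) ! (i + 1)} =
    {i. i = 0 \<and> a > b} \<union> Suc ` {i. i + 1 < length (b # r) \<and> (b # r) ! i > (b # r) ! (i + 1)}"
    (is "?L = _ \<union> Suc ` ?R")
  proof (intro set_eqI)
    fix i show "i \<in> ?L \<longleftrightarrow> i \<in> {i. i = 0 \<and> a > b} \<union> Suc ` ?R"
      by (cases i) auto
  qed
  moreover have "finite ?R" by simp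
  ultimately have "card ?L = card {i::nat. i = 0 \<and> a > b} + card (Suc ` ?R)"
    by (simp only:) (rule card_Un_disjoint, auto)
  thus ?thesis by (simp add: des_def card_image)
qed

text \<open>The exponent of $y$; the empty permutation contributes the constant term 1.\<close>

definition runs :: "'a::linorder list \<Rightarrow> nat" where
  "runs \<sigma> = (if \<sigma> = [] then 0 else 1 + des \<sigma>)"

text \<open>The letter before \<open>m\<close> is larger, so \<open>m\<close> opens a new run;
  \<open>runs [] = 0\<close> covers empty \<alpha>.\<close>

lemma runs_append_min:
  assumes "\<forall>a\<in>set \<alpha>. m < a"
  shows "runs (\<alpha> @ m # \<beta>) = runs \<alpha> + runs (m # \<beta>)"
  using assms
proof (induction \<alpha>)
  case (Cons a \<alpha>)
  thus ?case by (cases \<alpha>) (auto simp: runs_def)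
qed (simp add: runs_def)

lemma LRmin_Nil [simp]: "LRmin [] = 0"
  by (simp add: LRmin_def)

lemma LRmin_snoc: "LRmin (\<alpha> @ [z]) = LRmin \<alpha> + of_bool (\<forall>a\<in>set \<alpha>. z < a)"
proof -
  let ?A = "{j. j < length \<alpha> \<and> (\<forall>i<j. \<alpha> ! j < \<alpha> ! i)}"
  have "{j. j < length (\<alpha> @ [z]) \<and> (\<forall>i<j. (\<alpha> @ [z]) ! j < (\<alpha> @ [z]) ! i)} =
    ?A \<union> {j. j = length \<alpha> \<and> (\<forall>a\<in>set \<alpha>. z < a)}"
    by (auto simp: nth_append less_Suc_eq all_set_conv_all_nth)
  moreover have "card (?A \<union> {j. j = length \<alpha> \<and> (\<forall>a\<in>set \<alpha>. z < a)}) =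
    card ?A + card {j. j = length \<alpha> \<and> (\<forall>a\<in>set \<alpha>. z < a)}"
    by (rule card_Un_disjoint) auto
  ultimately show ?thesis by (simp add: LRmin_def)
qed

text \<open>Every letter of \<alpha> exceeds \<open>m\<close>, so \<open>m\<close> is one more
  left-to-right minimum, and it rules out all letters after it.\<close>

lemma LRmin_append_min:
  assumes "\<forall>a\<in>set \<alpha>. m < a" "\<forall>b\<in>set \<beta>. m < b"
  shows "LRmin (\<alpha> @ m # \<beta>) = Suc (LRmin \<alpha>)"
  using assms(2)
proof (induction \<beta> rule: rev_induct)
  case Nil
  thus ?case using assms(1) by (simp add: LRmin_snoc)
next
  case (snoc z \<beta>)
  hence "\<not> (\<forall>a\<in>set (\<alpha> @ m # \<beta>). z < a)" by (auto simp: not_less)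
  thus ?case using snoc LRmin_snoc[of "\<alpha> @ m # \<beta>" z] by simp
qed


subsection \<open>Decomposition at the minimum\<close>

definition avoiders :: "'a::linorder set \<Rightarrow> 'a list set" where
  "avoiders X = {\<sigma> \<in> permutations_of_set X. avoids \<sigma>}"

lemma finite_avoiders [simp]: "finite (avoiders X)"
  by (simp add: avoiders_def)

lemma mem_avoiders_iff: "\<sigma> \<in> avoiders X \<longleftrightarrow> distinct \<sigma> \<and> set \<sigma> = X \<and> avoids \<sigma>"
  by (auto simp: avoiders_def permutations_of_set_def)

lemma avoiders_empty [simp]: "avoiders {} = {[]}"
  by (auto simp: mem_avoiders_iff)

definition avoiders_sum :: "'b::field_char_0 \<Rightarrow> 'b \<Rightarrow> 'a::linorder set \<Rightarrow> 'b" where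
  "avoiders_sum x y X = (\<Sum>\<sigma>\<in>avoiders X. x ^ LRmin \<sigma> * y ^ runs \<sigma>)"

definition min_first_avoiders :: "'a::linorder \<Rightarrow> 'a set \<Rightarrow> 'a list set" where
  "min_first_avoiders m T = {\<beta> \<in> permutations_of_set T. avoids (m # \<beta>)}"

text \<open>There is no power of \<open>x\<close>, since nothing after the minimum is a
  left-to-right minimum. This independence of \<open>x\<close> allows the sum to be computed at
  \<open>x = 1\<close>.\<close>

definition min_first_sum :: "'b::field_char_0 \<Rightarrow> 'a::linorder \<Rightarrow> 'a set \<Rightarrow> 'b" where
  "min_first_sum y m T = (\<Sum>\<beta>\<in>min_first_avoiders m T. y ^ runs (m # \<beta>))"

text \<open>Cutting at \<open>m\<close> leaves an arbitrary avoider on \<open>V - T\<close> before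
  it and a word on \<open>T\<close> after it; the factor \<open>x\<close> records \<open>m\<close>
  itself. This is the coefficient form of P' = x B P.\<close>

lemma avoiders_sum_insert_min:
  fixes x y :: "'b::field_char_0" and V :: "'a::linorder set"
  assumes "finite V" and min: "\<forall>v\<in>V. m < v"
  shows "avoiders_sum x y (insert m V) =
    x * (\<Sum>T\<in>Pow V. min_first_sum y m T * avoiders_sum x y (V - T))"
proof -
  let ?S = "SIGMA T:Pow V. min_first_avoiders m T \<times> avoiders (V - T)"
  have *: "\<forall>a\<in>set \<alpha>. m < a" "\<forall>b\<in>set \<beta>. m < b"
    if "T \<subseteq> V" "\<beta> \<in> min_first_avoiders m T" "\<alpha> \<in> avoiders (V - T)" for T \<alpha> \<beta>
    using that min by (auto simp: min_first_avoiders_def mem_avoiders_iff permutations_of_set_def)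
  have mV: "m \<notin> V" using min by auto
  have "x * (\<Sum>T\<in>Pow V. min_first_sum y m T * avoiders_sum x y (V - T)) =
    (\<Sum>T\<in>Pow V. \<Sum>(\<beta>, \<alpha>)\<in>min_first_avoiders m T \<times> avoiders (V - T).
       x * (y ^ runs (m # \<beta>) * (x ^ LRmin \<alpha> * y ^ runs \<alpha>)))"
    unfolding min_first_sum_def avoiders_sum_def
    by (simp only: sum_product sum.cartesian_product) (simp add: sum_distrib_left case_prod_unfold)
  also have "\<dots> = (\<Sum>(T, \<beta>, \<alpha>)\<in>?S. x * (y ^ runs (m # \<beta>) * (x ^ LRmin \<alpha> * y ^ runs \<alpha>)))"
    using \<open>finite V\<close> by (subst sum.Sigma) (auto simp: min_first_avoiders_def)
  also have "\<dots> = (\<Sum>\<sigma>\<in>avoiders (insert m V). x ^ LRmin \<sigma> * y ^ runs \<sigma>)"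
  proof (rule sum.reindex_bij_witness[where
      j = "\<lambda>(T, \<beta>, \<alpha>). \<alpha> @ m # \<beta>" and
      i = "\<lambda>\<sigma>. (set (tl (dropWhile (\<lambda>a. a \<noteq> m) \<sigma>)), tl (dropWhile (\<lambda>a. a \<noteq> m) \<sigma>),
                 takeWhile (\<lambda>a. a \<noteq> m) \<sigma>)"], goal_cases)
    case (1 p)
    then obtain T \<beta> \<alpha> where p: "p = (T, \<beta>, \<alpha>)"
      "T \<subseteq> V" "\<beta> \<in> min_first_avoiders m T" "\<alpha> \<in> avoiders (V - T)" by auto
    have "m \<notin> set \<alpha>" using *(1)[OF p(2-4)] by auto
    hence "takeWhile (\<lambda>a. a \<noteq> m) (\<alpha> @ m # \<beta>) = \<alpha>" "dropWhile (\<lambda>a. a \<noteq> m) (\<alpha> @ m # \<beta>) = m # \<beta>"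
      by (metis (mono_tags, lifting) takeWhile_append2 append.right_neutral takeWhile.simps(2))
         (metis (mono_tags, lifting) \<open>m \<notin> set \<alpha>\<close> dropWhile_append2 dropWhile.simps(2))
    thus ?case using p by (simp add: min_first_avoiders_def permutations_of_set_def)
  next
    case (2 p)
    then obtain T \<beta> \<alpha> where p: "p = (T, \<beta>, \<alpha>)"
      "T \<subseteq> V" "\<beta> \<in> min_first_avoiders m T" "\<alpha> \<in> avoiders (V - T)" by auto
    thus ?case using *[OF p(2-4)] avoids_append_min[of \<alpha> m \<beta>] mV
      by (auto simp: mem_avoiders_iff min_first_avoiders_def permutations_of_set_def)
  next
    case (3 \<sigma>)
    hence "m \<in> set \<sigma>" by (auto simp: mem_avoiders_iff)
    hence "dropWhile (\<lambda>a. a \<noteq> m) \<sigma> \<noteq> []" "hd (dropWhile (\<lambda>a. a \<noteq> m) \<sigma>) = m"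
      by (auto simp: hd_dropWhile dropWhile_eq_Nil_conv)
         (metis (mono_tags, lifting) dropWhile_eq_Nil_conv hd_dropWhile)
    hence "m # tl (dropWhile (\<lambda>a. a \<noteq> m) \<sigma>) = dropWhile (\<lambda>a. a \<noteq> m) \<sigma>" by (metis list.collapse)
    thus ?case by simp
  next
    case (4 \<sigma>)
    hence \<sigma>: "distinct \<sigma>" "set \<sigma> = insert m V" "avoids \<sigma>" by (auto simp: mem_avoiders_iff)
    then obtain \<alpha> \<beta> where ab: "\<sigma> = \<alpha> @ m # \<beta>" "m \<notin> set \<alpha>"
      by (metis insertI1 split_list_first)
    hence "takeWhile (\<lambda>a. a \<noteq> m) \<sigma> = \<alpha>" "dropWhile (\<lambda>a. a \<noteq> m) \<sigma> = m # \<beta>"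
      by (metis (mono_tags, lifting) takeWhile_append2 append.right_neutral takeWhile.simps(2))
         (metis (mono_tags, lifting) ab dropWhile_append2 dropWhile.simps(2))
    moreover have sets: "set \<alpha> \<union> set \<beta> = V" "set \<alpha> \<inter> set \<beta> = {}" "m \<notin> set \<beta>"
      using \<sigma> ab mV by auto
    moreover have "avoids \<alpha> \<and> avoids (m # \<beta>)"
      using sets min avoids_append_min[of \<alpha> m \<beta>] \<sigma>(3) ab(1) by auto
    ultimately show ?case using \<sigma>(1) ab(1)
      by (auto simp: mem_avoiders_iff min_first_avoiders_def permutations_of_set_def)
  next
    case (5 p)
    then obtain T \<beta> \<alpha> where p: "p = (T, \<beta>, \<alpha>)"
      "T \<subseteq> V" "\<beta> \<in> min_first_avoiders m T" "\<alpha> \<in> avoiders (V - T)" by auto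
    thus ?case using *[OF p(2-4)] by (simp add: runs_append_min LRmin_append_min power_add)
  qed
  finally show ?thesis by (simp add: avoiders_sum_def)
qed

subsection \<open>Permutations as sequences of bricks\<close>

text \<open>A brick \<open>(a, b)\<close> with \<open>a < b\<close> stands for an increasing run of length two, and \<open>(a, a)\<close> for a
  run of length one.\<close>

fun brick_word :: "('a \<times> 'a) list \<Rightarrow> 'a list" where
  "brick_word [] = []"
| "brick_word ((a, b) # ps) = (if a = b then [a] else [a, b]) @ brick_word ps"

text \<open>The factorization is greedy: a longer increasing run is cut into pairs, so bricks
  coincide with runs only when no run exceeds length two.\<close>

fun bricks :: "'a::linorder list \<Rightarrow> ('a \<times> 'a) list" where
  "bricks [] = []"
| "bricks [a] = [(a, a)]"
| "bricks (a # b # r) = (if a < b then (a, b) # bricks r else (a, a) # bricks (b # r))"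

definition brick_less :: "'a::linorder \<times> 'a \<Rightarrow> 'a \<times> 'a \<Rightarrow> bool" where
  "brick_less p q \<longleftrightarrow> fst p < fst q \<and> snd p < snd q"

lemma brick_word_bricks [simp]: "brick_word (bricks \<sigma>) = \<sigma>"
  by (induction \<sigma> rule: bricks.induct) auto

lemma bricks_le: "(a, b) \<in> set (bricks \<sigma>) \<Longrightarrow> a \<le> b"
  by (induction \<sigma> rule: bricks.induct) (auto split: if_splits)

lemma bricks_Cons_cases:
  obtains d r where "\<sigma> = d # r" "c < d" "bricks (c # \<sigma>) = (c, d) # bricks r"
  | "bricks (c # \<sigma>) = (c, c) # bricks \<sigma>" "\<And>d r. \<sigma> = d # r \<Longrightarrow> d \<le> c"
proof (cases \<sigma>)
  case (Cons d r)
  thus ?thesis using that by (cases "c < d") auto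
qed (use that in auto)

lemma bricks_eq_Nil_iff [simp]: "bricks \<sigma> = [] \<longleftrightarrow> \<sigma> = []"
  by (cases \<sigma> rule: bricks.cases) auto

lemma head_match_Cons_Cons_Cons:
  "head_match (a # b # c # r) \<longleftrightarrow> a < b \<and> b < c \<or> a < c \<and> c < b \<and> (\<exists>d r'. r = d # r' \<and> b < d)"
  by (cases r) auto

text \<open>Two consecutive bricks of length two \<open>(a, b)\<close>, \<open>(c, d)\<close> with \<open>a < c\<close> and \<open>b < d\<close> contain a $123$-match if
  \<open>b < c\<close> and a $1324$-match otherwise.\<close>

lemma avoids_iff_bricks:
  "distinct \<sigma> \<Longrightarrow> avoids \<sigma> \<longleftrightarrow> successively (\<lambda>p q. \<not> brick_less p q) (bricks \<sigma>)"
proof (induction \<sigma> rule: bricks.induct)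
  case (2 a)
  thus ?case by (simp add: avoids_Cons)
next
  case (3 a b r)
  show ?case
  proof (cases "a < b")
    case False
    hence "\<not> head_match (a # b # r)" by (cases r) (auto simp: head_match_Cons_Cons_Cons)
    moreover have "\<not> brick_less (a, a) (hd (bricks (b # r)))"
      using False by (cases rule: bricks_Cons_cases[where c = b and \<sigma> = r]) (auto simp: brick_less_def)
    ultimately show ?thesis using 3 False
      by (auto simp: avoids_Cons[of a] successively_Cons simp del: bricks.simps(3) head_match.simps
           simp: bricks.simps(3)[of a])
  next
    case True
    show ?thesis
    proof (cases r)
      case Nil
      thus ?thesis using True by (simp add: avoids_Cons)
    next
      case (Cons c r')
      have dist: "b \<noteq> c" "\<And>d. d \<in> set r' \<Longrightarrow> c \<noteq> d \<and> b \<noteq> d" using 3 Cons by auto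
      \<comment> \<open>The recursion consumes \<open>a\<close> and \<open>b\<close> together, so
        matches starting at either letter are considered. One starting at \<open>b\<close> forces
        \<open>b < c\<close>, hence also a 123-match at \<open>a\<close>.\<close>
      have "brick_less (a, b) (hd (bricks r)) \<longleftrightarrow> head_match (a # b # r) \<or> head_match (b # r)"
        unfolding Cons
      proof (cases rule: bricks_Cons_cases[where c = c and \<sigma> = r'])
        case (1 d s)
        thus "brick_less (a, b) (hd (bricks (c # r'))) \<longleftrightarrow>
            head_match (a # b # c # r') \<or> head_match (b # c # r')"
          using True dist by (auto simp: brick_less_def head_match_Cons_Cons_Cons)
      next
        case 2
        thus "brick_less (a, b) (hd (bricks (c # r'))) \<longleftrightarrow>
            head_match (a # b # c # r') \<or> head_match (b # c # r')"
          using True dist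
          by (cases r') (fastforce simp: brick_less_def head_match_Cons_Cons_Cons)+
      qed
      moreover have "bricks r \<noteq> []" using Cons by simp
      ultimately show ?thesis using 3 True
        by (auto simp: avoids_Cons[of a] avoids_Cons[of b] successively_Cons simp del: head_match.simps)
    qed
  qed
qed simp

text \<open>Every boundary between bricks is a descent: an ascent after \<open>(a, b)\<close> would
  put the next brick above it in both coordinates, and a singleton brick arises only before a
  descent or at the end.\<close>

lemma length_bricks:
  "distinct \<sigma> \<Longrightarrow> successively (\<lambda>p q. \<not> brick_less p q) (bricks \<sigma>) \<Longrightarrow> length (bricks \<sigma>) = runs \<sigma>"
proof (induction \<sigma> rule: bricks.induct)
  case (3 a b r)
  show ?case
  proof (cases "a < b")
    case False
    thus ?thesis using 3 by (auto simp: runs_def successively_Cons simp del: bricks.simps(3)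
           simp: bricks.simps(3)[of a])
  next
    case True
    show ?thesis
    proof (cases r)
      case Nil
      thus ?thesis using True by (simp add: runs_def)
    next
      case (Cons c r')
      have "\<not> brick_less (a, b) (hd (bricks r))"
        using 3 True Cons by (auto simp: successively_Cons)
      hence "c < b" using 3 True unfolding Cons
        by (cases rule: bricks_Cons_cases[where c = c and \<sigma> = r']) (auto simp: brick_less_def)
      thus ?thesis using 3 True Cons by (auto simp: runs_def successively_Cons)
    qed
  qed
qed (simp_all add: runs_def)


section \<open>Brick sequences on a given set of letters\<close>

definition brickings :: "'a::linorder set \<Rightarrow> ('a \<times> 'a) list set" where
  "brickings X = {ps. (\<forall>(a, b)\<in>set ps. a \<le> b) \<and> distinct (brick_word ps) \<and> set (brick_word ps) = X}"

lemma set_brick_word: "set (brick_word ps) = fst ` set ps \<union> snd ` set ps"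
  by (induction ps rule: brick_word.induct) auto

lemma brick_word_append: "brick_word (ps @ qs) = brick_word ps @ brick_word qs"
  by (induction ps rule: brick_word.induct) auto

lemma length_le_length_brick_word: "length ps \<le> length (brick_word ps)"
  by (induction ps rule: brick_word.induct) auto

lemma distinct_brick_word_Cons:
  "distinct (brick_word ((a, b) # ps)) \<longleftrightarrow>
     a \<notin> set (brick_word ps) \<and> b \<notin> set (brick_word ps) \<and> distinct (brick_word ps)"
  by auto

lemma finite_brickings [simp]:
  assumes "finite X"
  shows "finite (brickings X)"
proof (rule finite_subset)
  show "brickings X \<subseteq> {ps. set ps \<subseteq> X \<times> X \<and> length ps \<le> card X}"
  proof
    fix ps assume ps: "ps \<in> brickings X"
    have "length ps \<le> card X"
      using length_le_length_brick_word[of ps] ps by (auto simp: brickings_def distinct_card[symmetric])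
    moreover have "set ps \<subseteq> X \<times> X"
      using ps set_brick_word[of ps] by (force simp: brickings_def)
    ultimately show "ps \<in> {ps. set ps \<subseteq> X \<times> X \<and> length ps \<le> card X}" by simp
  qed
  show "finite {ps. set ps \<subseteq> X \<times> X \<and> length ps \<le> card X}"
    using assms by (intro finite_lists_length_le) auto
qed

text \<open>Greedy parsing could go wrong only by merging a singleton \<open>(a, a)\<close> with the
  first letter \<open>c\<close> of the next brick \<open>(c, d)\<close>. But \<open>a < c\<close>
  and \<open>c \<le> d\<close> would give \<open>brick_less (a, a) (c, d)\<close>.\<close>

lemma bricks_brick_word:
  assumes "\<forall>(a, b)\<in>set ps. a \<le> b" "successively (\<lambda>p q. \<not> brick_less p q) ps"
  shows "bricks (brick_word ps) = ps"
  using assms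
proof (induction ps rule: brick_word.induct)
  case (2 a b ps)
  show ?case
  proof (cases "a = b")
    case False
    thus ?thesis using 2 by (auto simp: successively_Cons)
  next
    case True
    show ?thesis
    proof (cases ps)
      case Nil
      thus ?thesis using True by simp
    next
      case (Cons q qs)
      obtain c d where q: "q = (c, d)" by force
      hence "c \<le> a" using 2 True Cons by (auto simp: brick_less_def)
      moreover obtain r where r: "brick_word ps = c # r" using Cons q by (cases "c = d") auto
      ultimately show ?thesis using 2 True by (auto simp: successively_Cons)
    qed
  qed
qed simp

lemma avoiders_sum_eq_brickings:
  "avoiders_sum 1 y X =
     (\<Sum>ps\<in>{ps\<in>brickings X. successively (\<lambda>p q. \<not> brick_less p q) ps}. y ^ length ps)"
  unfolding avoiders_sum_def
  by (rule sum.reindex_bij_witness[where i = brick_word and j = bricks])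
     (auto simp: mem_avoiders_iff avoids_iff_bricks brickings_def bricks_le bricks_brick_word length_bricks)

text \<open>If \<open>L\<close> is the length of the longest prefix that is a \<open>\<not> P\<close>-chain, then only the cuts at \<open>L - 1\<close>
  and \<open>L\<close> can contribute, and they cancel.\<close>

lemma sum_cuts_eq_0:
  assumes "ps \<noteq> []"
  shows "(\<Sum>i\<le>length ps. of_bool (successively (\<lambda>p q. \<not> P p q) (take i ps) \<and> successively P (drop i ps))
            * (- 1) ^ (length ps - i)) = (0 :: 'b::comm_ring_1)"
  using assms
proof (induction ps rule: induct_list012)
  case (2 p)
  show ?case by simp
next
  case (3 p q ps)
  let ?f = "\<lambda>ps i. of_bool (successively (\<lambda>p q. \<not> P p q) (take i ps) \<and> successively P (drop i ps))
            * (- 1) ^ (length ps - i) :: 'b"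
  have "(\<Sum>i\<le>length (p # q # ps). ?f (p # q # ps) i) =
     ?f (p # q # ps) 0 + ?f (p # q # ps) 1 + (\<Sum>i\<le>length ps. ?f (p # q # ps) (Suc (Suc i)))"
    by (simp add: sum.atMost_Suc_shift del: sum.atMost_Suc)
  moreover have "(\<Sum>i\<le>length (q # ps). ?f (q # ps) i) = ?f (q # ps) 0 + (\<Sum>i\<le>length ps. ?f (q # ps) (Suc i))"
    by (simp add: sum.atMost_Suc_shift del: sum.atMost_Suc)
  moreover have "(\<Sum>i\<le>length (q # ps). ?f (q # ps) i) = 0" using 3 by simp
  \<comment> \<open>If \<open>P p q\<close> holds, the cuts at 0 and 1 cancel and the others vanish.
    Otherwise the cut at 0 vanishes and the rest reproduce the sum for
    \<open>q # ps\<close>.\<close>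
  ultimately show ?case by (cases "P p q") auto
qed simp

text \<open>The state of a left-to-right scan of the letters: \<open>Q\<close> holds those already
  read as first letters of bricks still open, so they may not be second components; \<open>X\<close>
  holds the unread ones.\<close>

definition chains :: "'a::linorder set \<Rightarrow> 'a set \<Rightarrow> ('a \<times> 'a) list set" where
  "chains Q X = {ps \<in> brickings (Q \<union> X). sorted_wrt brick_less ps \<and> snd ` set ps \<subseteq> X}"

lemma transp_brick_less: "transp brick_less"
  by (auto simp: transp_def brick_less_def)

lemma chains_empty_left: "chains {} X = {ps \<in> brickings X. successively brick_less ps}"
  using successively_conv_sorted_wrt[OF transp_brick_less]
  by (auto simp: chains_def brickings_def set_brick_word)

lemma finite_chains [simp]: "finite Q \<Longrightarrow> finite X \<Longrightarrow> finite (chains Q X)"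
  by (simp add: chains_def)

text \<open>An avoider and a chain on complementary letters concatenate to an arbitrary brick
  sequence with a marked cut. The signs in \<open>(- y)\<close> make the cuts of each nonempty
  sequence cancel, by \<open>sum_cuts_eq_0\<close>.\<close>

lemma avoiders_sum_conv_chains:
  fixes y :: "'b::field_char_0" and X :: "'a::linorder set"
  assumes "finite X"
  shows "(\<Sum>S\<in>Pow X. avoiders_sum 1 y S * (\<Sum>qs\<in>chains {} (X - S). (- y) ^ length qs)) = of_bool (X = {})"
proof -
  let ?N = "successively (\<lambda>p q. \<not> brick_less p q)" and ?P = "successively brick_less"
  let ?A = "\<lambda>S. {ps\<in>brickings S. ?N ps}"
  let ?S = "SIGMA S:Pow X. ?A S \<times> chains {} (X - S)"
  let ?T = "SIGMA rs:brickings X. {i. i \<le> length rs \<and> ?N (take i rs) \<and> ?P (drop i rs)}"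
  have fin: "finite S" if "S \<subseteq> X" for S using that assms finite_subset by blast
  have "(\<Sum>S\<in>Pow X. avoiders_sum 1 y S * (\<Sum>qs\<in>chains {} (X - S). (- y) ^ length qs)) =
    (\<Sum>S\<in>Pow X. \<Sum>(ps, qs)\<in>?A S \<times> chains {} (X - S). y ^ length ps * (- y) ^ length qs)"
    unfolding avoiders_sum_eq_brickings by (simp only: sum_product sum.cartesian_product)
  also have "\<dots> = (\<Sum>(S, ps, qs)\<in>?S. y ^ length ps * (- y) ^ length qs)"
    using assms by (subst sum.Sigma) (auto simp: fin)
  also have "\<dots> = (\<Sum>(rs, i)\<in>?T. y ^ length rs * (- 1) ^ (length rs - i))"
  proof (rule sum.reindex_bij_witness[where
      j = "\<lambda>(S, ps, qs). (ps @ qs, length ps)" and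
      i = "\<lambda>(rs, i). (set (brick_word (take i rs)), take i rs, drop i rs)"], goal_cases)
    case (4 p)
    then obtain rs i where p: "p = (rs, i)" "rs \<in> brickings X" "?N (take i rs)" "?P (drop i rs)" by auto
    have "brick_word rs = brick_word (take i rs) @ brick_word (drop i rs)"
      by (metis append_take_drop_id brick_word_append)
    moreover have "set (take i rs) \<subseteq> set rs" "set (drop i rs) \<subseteq> set rs"
      by (rule set_take_subset, rule set_drop_subset)
    ultimately show ?case using p by (auto simp: brickings_def chains_empty_left)
  next
    case (5 p)
    then obtain S ps qs where p: "p = (S, ps, qs)" by (cases p) auto
    have "(- y) ^ length qs = (- 1) ^ length qs * y ^ length qs" by (rule power_minus)
    thus ?case by (simp add: p power_add)
  qed (auto simp: brickings_def brick_word_append chains_empty_left)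
  also have "\<dots> = (\<Sum>rs\<in>brickings X. y ^ length rs * (\<Sum>i\<le>length rs.
      of_bool (?N (take i rs) \<and> ?P (drop i rs)) * (- 1) ^ (length rs - i)))"
  proof (subst sum.Sigma[symmetric])
    show "(\<Sum>rs\<in>brickings X. \<Sum>i\<in>{i. i \<le> length rs \<and> ?N (take i rs) \<and> ?P (drop i rs)}.
        y ^ length rs * (- 1) ^ (length rs - i)) =
      (\<Sum>rs\<in>brickings X. y ^ length rs * (\<Sum>i\<le>length rs.
        of_bool (?N (take i rs) \<and> ?P (drop i rs)) * (- 1) ^ (length rs - i)))"
      unfolding sum_distrib_left
      by (intro sum.cong refl sum.mono_neutral_cong_left) auto
  qed (use assms in auto)
  also have "\<dots> = (\<Sum>rs\<in>brickings X. of_bool (rs = []))"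
    by (intro sum.cong refl) (use sum_cuts_eq_0[of _ brick_less] in auto)
  also have "\<dots> = of_bool (X = {})"
  proof -
    have "rs = [] \<longleftrightarrow> X = {}" if "rs \<in> brickings X" for rs
      using that by (auto simp: brickings_def set_brick_word)
    moreover have "brickings ({} :: 'a set) = {[]}" by (auto simp: brickings_def set_brick_word)
    ultimately show ?thesis by (cases "X = {}") (auto intro: sum.neutral)
  qed
  finally show ?thesis .
qed

subsection \<open>Counting chains\<close>

text \<open>The least unread letter \<open>m\<close> either opens a brick and joins
  \<open>Q\<close>, or closes one. In the second case monotone second components make that brick the
  first of the chain, and monotone first components make its partner \<open>a\<close> the least open
  letter. If \<open>Q\<close> is empty, then \<open>a = m\<close> and the brick is a
  singleton.\<close>

lemma chains_Min_recursion:
  assumes "finite Q" "finite X" "X \<noteq> {}" and QX: "\<forall>q\<in>Q. \<forall>x\<in>X. q < x"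
    and m: "m = Min X" and a: "a = Min (insert m Q)"
  shows "chains Q X = chains (insert m Q) (X - {m}) \<union> (#) (a, m) ` chains (Q - {a}) (X - {m})"
proof -
  have mX: "m \<in> X" and mle: "\<And>x. x \<in> X \<Longrightarrow> m \<le> x"
    using assms by (auto simp: m)
  have aQ: "a \<in> insert m Q" and ale: "\<And>x. x \<in> insert m Q \<Longrightarrow> a \<le> x"
    unfolding a using \<open>finite Q\<close> Min_in[of "insert m Q"] by (auto simp del: Min_insert)
  have aleX: "a \<le> x" if "x \<in> Q \<union> X" for x
    using that ale mle by (metis Un_iff insert_iff order_trans)
  have sets: "(Q - {a}) \<union> (X - {m}) = Q \<union> X - {a, m}"
    using QX aQ mX by auto
  \<comment> \<open>Opening a brick at \<open>m\<close> means exactly that \<open>m\<close> is not a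
    second component.\<close>
  have open_eq: "chains (insert m Q) (X - {m}) = {ps \<in> chains Q X. m \<notin> snd ` set ps}"
    using mX by (auto simp: chains_def brickings_def)
  have close: "(a, m) # ps \<in> chains Q X" if ps: "ps \<in> chains (Q - {a}) (X - {m})" for ps
  proof -
    have w: "set (brick_word ps) = Q \<union> X - {a, m}" and s: "snd ` set ps \<subseteq> X - {m}"
      using ps by (auto simp: chains_def brickings_def sets)
    have "brick_less (a, m) q" if "q \<in> set ps" for q
    proof -
      have "snd q \<in> X" "snd q \<noteq> m" using s that by auto
      moreover have "fst q \<in> Q \<union> X" "fst q \<noteq> a" using w that unfolding set_brick_word by auto
      ultimately show ?thesis using mle[of "snd q"] aleX[of "fst q"] by (auto simp: brick_less_def)
    qed
    moreover have "a \<le> m" using ale by simp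
    moreover have "set (brick_word ((a, m) # ps)) = Q \<union> X" using w aQ mX by auto
    moreover have "distinct (brick_word ((a, m) # ps))"
      unfolding distinct_brick_word_Cons using w ps by (auto simp: chains_def brickings_def)
    ultimately show ?thesis using ps s mX by (auto simp: chains_def brickings_def)
  qed
  have closed: "ps \<in> (#) (a, m) ` chains (Q - {a}) (X - {m})"
    if ps: "ps \<in> chains Q X" and mps: "m \<in> snd ` set ps" for ps
  proof -
    obtain c d qs where eq: "ps = (c, d) # qs" using mps by (cases ps) auto
    have w: "set (brick_word ps) = Q \<union> X" and s: "snd ` set ps \<subseteq> X" and "c \<le> d"
      and less: "\<And>q. q \<in> set qs \<Longrightarrow> c < fst q \<and> d < snd q"
      using ps eq by (auto simp: chains_def brickings_def brick_less_def)
    have "d \<in> X" using s eq by simp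
    hence "d = m" using mps less mle[of d] eq by force
    have "c \<in> Q \<union> X" using w eq by (auto split: if_splits)
    hence "c \<in> insert m Q" using \<open>c \<le> d\<close> \<open>d = m\<close> mle[of c] by auto
    hence "a \<le> c" using ale by simp
    have "a \<in> Q \<union> X" using aQ mX by auto
    hence "a \<in> fst ` set ps \<or> a \<in> snd ` set ps" using w set_brick_word[of ps] by blast
    \<comment> \<open>\<open>c\<close> is the least letter of the whole chain: first components
      increase, and each second component is at least \<open>d\<close>, hence at least
      \<open>c\<close>.\<close>
    hence "c \<le> a" using eq less \<open>c \<le> d\<close> by force
    hence "c = a" using \<open>a \<le> c\<close> by simp
    have "distinct (brick_word ((a, m) # qs))"
      using ps eq \<open>c = a\<close> \<open>d = m\<close> by (simp add: chains_def brickings_def)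
    hence d: "a \<notin> set (brick_word qs)" "m \<notin> set (brick_word qs)" "distinct (brick_word qs)"
      unfolding distinct_brick_word_Cons by auto
    have "set (brick_word qs) = Q \<union> X - {a, m}"
      using w d(1,2) eq \<open>c = a\<close> \<open>d = m\<close> by (auto split: if_splits)
    moreover have "snd ` set qs \<subseteq> X - {m}"
      using s less \<open>d = m\<close> eq by force
    ultimately have "qs \<in> chains (Q - {a}) (X - {m})"
      using ps eq d(3) by (auto simp: chains_def brickings_def sets)
    thus ?thesis using eq \<open>c = a\<close> \<open>d = m\<close> by simp
  qed
  show ?thesis using open_eq close closed by auto
qed

text \<open>Paths from height \<open>h\<close> to $0$ with \<open>n\<close> steps, down steps weighted by \<open>z\<close>; since truncated
  subtraction gives \<open>0 - 1 = 0\<close>, a down step at height $0$ is a level step.\<close>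

fun path_sum :: "'b::comm_ring_1 \<Rightarrow> nat \<Rightarrow> nat \<Rightarrow> 'b" where
  "path_sum z 0 h = of_bool (h = 0)"
| "path_sum z (Suc n) h = path_sum z n (Suc h) + z * path_sum z n (h - 1)"

text \<open>The height is the number of open bricks: opening is an up step, closing a down step of
  weight \<open>z\<close>. A singleton brick is the level step at height 0, and a path must end at
  height 0 because every open brick has to be closed.\<close>

lemma sum_chains:
  fixes z :: "'b::comm_ring_1"
  assumes "finite Q" "finite X" "\<forall>q\<in>Q. \<forall>x\<in>X. q < x"
  shows "(\<Sum>ps\<in>chains Q X. z ^ length ps) = path_sum z (card X) (card Q)"
  using assms
proof (induction "card X" arbitrary: Q X)
  case 0
  hence "X = {}" by simp
  moreover have "chains Q {} = (if Q = {} then {[]} else {})"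
    by (auto simp: chains_def brickings_def)
  ultimately show ?case using 0 by auto
next
  case (Suc n)
  define m where "m = Min X"
  define a where "a = Min (insert m Q)"
  have "X \<noteq> {}" using Suc.hyps(2) by auto
  hence mX: "m \<in> X" and mle: "\<And>x. x \<in> X \<Longrightarrow> m \<le> x" using Suc.prems by (auto simp: m_def)
  have cX: "card (X - {m}) = n" using Suc.hyps(2) mX Suc.prems by simp
  have "m \<notin> Q" using mX Suc.prems by auto
  have aQ: "a \<in> insert m Q" and ale: "\<And>x. x \<in> insert m Q \<Longrightarrow> a \<le> x"
    unfolding a_def using Suc.prems Min_in[of "insert m Q"] by (auto simp del: Min_insert)
  \<comment> \<open>For empty \<open>Q\<close> both sides are 0 by truncated subtraction, which is
    the level step.\<close>
  have cQ: "card (Q - {a}) = card Q - 1"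
  proof (cases "Q = {}")
    case False
    then obtain q where "q \<in> Q" by auto
    hence "a < m" using ale[of q] Suc.prems(3) mX by force
    hence "a \<in> Q" using aQ by auto
    thus ?thesis using Suc.prems by simp
  qed simp
  have disj: "chains (insert m Q) (X - {m}) \<inter> (#) (a, m) ` chains (Q - {a}) (X - {m}) = {}"
    by (auto simp: chains_def)
  have "(\<Sum>ps\<in>chains Q X. z ^ length ps) =
    (\<Sum>ps\<in>chains (insert m Q) (X - {m}). z ^ length ps) +
    (\<Sum>ps\<in>(#) (a, m) ` chains (Q - {a}) (X - {m}). z ^ length ps)"
    unfolding chains_Min_recursion[OF Suc.prems(1,2) \<open>X \<noteq> {}\<close> Suc.prems(3) m_def a_def]
    using Suc.prems disj by (intro sum.union_disjoint) auto
  also have "(\<Sum>ps\<in>(#) (a, m) ` chains (Q - {a}) (X - {m}). z ^ length ps) =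
      z * (\<Sum>ps\<in>chains (Q - {a}) (X - {m}). z ^ length ps)"
    by (subst sum.reindex) (auto simp: sum_distrib_left)
  also have "(\<Sum>ps\<in>chains (Q - {a}) (X - {m}). z ^ length ps) = path_sum z n (card Q - 1)"
    using Suc.hyps(1)[of "X - {m}" "Q - {a}"] Suc.prems cX cQ by auto
  also have "(\<Sum>ps\<in>chains (insert m Q) (X - {m}). z ^ length ps) = path_sum z n (Suc (card Q))"
  proof -
    have "\<forall>q\<in>insert m Q. \<forall>x\<in>X - {m}. q < x" using Suc.prems(3) mle by force
    thus ?thesis using Suc.hyps(1)[of "X - {m}" "insert m Q"] Suc.prems cX \<open>m \<notin> Q\<close> by simp
  qed
  finally show ?case using Suc.hyps(2)[symmetric] by simp
qed

text \<open>\<open>j\<close> counts weighted steps, of which \<open>2 * j - n - h\<close> are level;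
  the coefficient is a ballot number, the same for every admissible \<open>h\<close>. The induction
  is Pascal's rule plus two boundary checks.\<close>

lemma path_sum_closed_form:
  fixes z :: "'b::comm_ring_1"
  shows "path_sum z n h =
    (\<Sum>j | j \<le> n \<and> n + h \<le> 2 * j. (of_nat (n choose j) - of_nat (n choose Suc j)) * z ^ j)"
proof (induction n arbitrary: h)
  case 0
  have "{j::nat. j \<le> 0 \<and> 0 + h \<le> 2 * j} = (if h = 0 then {0} else {})" by auto
  thus ?case by auto
next
  case (Suc n)
  let ?c = "\<lambda>n j. (of_nat (n choose j) - of_nat (n choose Suc j) :: 'b)"
  let ?J = "{j. j \<le> Suc n \<and> Suc n + h \<le> 2 * j}"
  have J0: "j \<noteq> 0" if "j \<in> ?J" for j using that by auto
  have pascal: "?c (Suc n) j = ?c n j + ?c n (j - 1)" if "j \<noteq> 0" for j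
    using that by (cases j) auto
  have "(\<Sum>j\<in>?J. ?c (Suc n) j * z ^ j) = (\<Sum>j\<in>?J. ?c n j * z ^ j) + (\<Sum>j\<in>?J. ?c n (j - 1) * z ^ j)"
    unfolding sum.distrib[symmetric]
    by (intro sum.cong refl, subst pascal) (auto simp: ring_distribs dest: J0)
  also have "(\<Sum>j\<in>?J. ?c n j * z ^ j) = path_sum z n (Suc h)"
    unfolding Suc.IH
  proof (rule sum.mono_neutral_right)
    show "\<forall>j\<in>?J - {j. j \<le> n \<and> n + Suc h \<le> 2 * j}. ?c n j * z ^ j = 0"
    proof
      fix j assume "j \<in> ?J - {j. j \<le> n \<and> n + Suc h \<le> 2 * j}"
      hence "j = Suc n" by auto
      thus "?c n j * z ^ j = 0" by (simp add: binomial_eq_0)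
    qed
  qed auto
  also have "(\<Sum>j\<in>?J. ?c n (j - 1) * z ^ j) =
      (\<Sum>j\<in>{j. j \<le> n \<and> n + h \<le> Suc (2 * j)}. ?c n j * z ^ Suc j)"
    by (rule sum.reindex_bij_witness[where i = Suc and j = "\<lambda>j. j - 1"]) (use J0 in auto)
  also have "\<dots> = (\<Sum>j\<in>{j. j \<le> n \<and> n + (h - 1) \<le> 2 * j}. ?c n j * z ^ Suc j)"
  \<comment> \<open>The ranges differ only for \<open>h = 0\<close>, at
    \<open>n = 2 * j + 1\<close>, where the two middle binomial coefficients are equal and the term
    is 0.\<close>
  proof (rule sum.mono_neutral_right)
    show "\<forall>j\<in>{j. j \<le> n \<and> n + h \<le> Suc (2 * j)} - {j. j \<le> n \<and> n + (h - 1) \<le> 2 * j}. ?c n j * z ^ Suc j = 0"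
    proof
      fix j assume j: "j \<in> {j. j \<le> n \<and> n + h \<le> Suc (2 * j)} - {j. j \<le> n \<and> n + (h - 1) \<le> 2 * j}"
      hence "n = 2 * j + 1" by auto
      hence "n choose j = n choose Suc j" using binomial_symmetric[of j n] by simp
      thus "?c n j * z ^ Suc j = 0" by simp
    qed
  qed auto
  also have "\<dots> = z * path_sum z n (h - 1)"
    unfolding Suc.IH by (simp add: sum_distrib_left mult_ac)
  finally show ?case by simp
qed


text \<open>Follows from \<open>Suc j * (N choose Suc j) = (N - j) * (N choose j)\<close>. The left
  side is the shape of the coefficients in \<open>U\<close>.\<close>

lemma ballot_number_eq_diff:
  assumes "j \<le> N" "N \<le> 2 * j"
  shows "of_nat ((2 * j + 1 - N) * (N choose (N - j))) / of_nat (Suc j) =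
    (of_nat (N choose j) - of_nat (N choose Suc j) :: 'b::field_char_0)"
proof -
  have "Suc j * (N choose Suc j) = (N - j) * (N choose j)"
    by (metis binomial_absorb_comp binomial_absorption)
  hence *: "of_nat (Suc j) * of_nat (N choose Suc j) = (of_nat N - of_nat j) * (of_nat (N choose j) :: 'b)"
    using assms(1) by (metis of_nat_diff of_nat_mult)
  have "of_nat ((2 * j + 1 - N) * (N choose (N - j))) =
      (2 * of_nat j + 1 - of_nat N) * (of_nat (N choose j) :: 'b)"
    using assms binomial_symmetric[of j N] by (simp add: of_nat_diff)
  also have "\<dots> = of_nat (Suc j) * of_nat (N choose j) - of_nat (Suc j) * of_nat (N choose Suc j)"
    unfolding * by (simp add: algebra_simps)
  finally show ?thesis by (simp add: field_simps del: of_nat_Suc)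
qed

lemma U_nth:
  fixes y :: "'a::field_char_0"
  shows "fact m * U y $ m = path_sum (- y) m 0"
proof (cases "m = 0")
  case True
  thus ?thesis by (simp add: U_def U_even_def U_odd_def)
next
  case False
  let ?t = "\<lambda>j. (of_nat (m choose j) - of_nat (m choose Suc j)) * (- y) ^ j"
  let ?J = "{j. j \<le> m \<and> m + 0 \<le> 2 * j}"
  show ?thesis
  proof (cases "even m")
    case True
    then obtain n where n: "m = 2 * n" by auto
    with False have "fact m * U y $ m =
      (\<Sum>k=0..n. of_nat ((2 * k + 1) * ((2 * n) choose (n - k))) / of_nat (n + k + 1) * (- y) ^ (n + k))"
      by (simp add: U_def U_even_def U_odd_def Let_def)
    also have "\<dots> = sum ?t ?J"
    \<comment> \<open>Since \<open>2 * j \<ge> 2 * n\<close>, the summation index is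
      \<open>k = j - n\<close>; in the odd case \<open>2 * j \<ge> 2 * n + 1\<close> shifts it to
      \<open>j - Suc n\<close>.\<close>
    proof (rule sum.reindex_bij_witness[where i = "\<lambda>j. j - n" and j = "\<lambda>k. n + k"], goal_cases)
      case (5 k)
      thus ?case using ballot_number_eq_diff[of "n + k" m, where 'b = 'a] n by simp
    qed (auto simp: n)
    finally show ?thesis by (simp add: path_sum_closed_form)
  next
    case odd: False
    then obtain n where n: "m = 2 * n + 1" by (auto elim: oddE)
    hence "fact m * U y $ m =
      (\<Sum>k=0..n. of_nat (2 * (k + 1) * ((2 * n + 1) choose (n - k))) / of_nat (n + k + 2) * (- y) ^ (n + k + 1))"
      using odd by (simp add: U_def U_even_def U_odd_def Let_def del: fact_Suc)
    also have "\<dots> = sum ?t ?J"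
    proof (rule sum.reindex_bij_witness[where i = "\<lambda>j. j - Suc n" and j = "\<lambda>k. Suc n + k"], goal_cases)
      case (5 k)
      have "2 * (Suc n + k) + 1 - m = 2 * (k + 1)" "m - (Suc n + k) = n - k"
        "Suc (Suc n + k) = n + k + 2" "Suc n + k = n + k + 1" using n by auto
      thus ?case using 5 ballot_number_eq_diff[of "Suc n + k" m, where 'b = 'a] n by simp
    qed (auto simp: n)
    finally show ?thesis by (simp add: path_sum_closed_form)
  qed
qed

subsection \<open>The generating function\<close>

lemma U_0 [simp]: "U y $ 0 = 1"
  by (simp add: U_def U_even_def U_odd_def)

text \<open>\<open>U y\<close> enumerates the chains with weight \<open>- y\<close> per brick, and
  its convolution with the avoiders is the indicator of the empty set, whose series is 1.\<close>

lemma avoiders_sum_1: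
  fixes y :: "'b::field_char_0"
  assumes "finite X"
  shows "avoiders_sum 1 y X = fact (card X) * inverse (U y) $ card X"
proof (rule egf_quotient[OF assms])
  show "U y $ 0 \<noteq> 0" by simp
  show "1 = inverse (U y) * U y" by (simp add: inverse_mult_eq_1)
  fix V assume "V \<subseteq> X"
  hence V: "finite V" using assms finite_subset by blast
  have "fact (card (V - T)) * U y $ card (V - T) = (\<Sum>qs\<in>chains {} (V - T). (- y) ^ length qs)" for T
    using sum_chains[of "{}" "V - T" "- y"] V by (simp add: U_nth)
  thus "(\<Sum>T\<in>Pow V. avoiders_sum 1 y T * (fact (card (V - T)) * U y $ card (V - T))) =
      fact (card V) * 1 $ card V"
    using avoiders_sum_conv_chains[OF V, of y] V by simp
qed

text \<open>The recursion at the minimum, taken at \<open>x = 1\<close> where P = 1/U, reads (1/U)'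
  = B (1/U) and is solved for B.\<close>

lemma min_first_sum_eq:
  fixes y :: "'b::field_char_0"
  assumes "finite X" "\<forall>v\<in>X. m < v"
  shows "min_first_sum y m X = fact (card X) * (U y * fps_deriv (inverse (U y))) $ card X"
proof (rule egf_quotient[OF assms(1)])
  show "inverse (U y) $ 0 \<noteq> 0" by simp
  show "fps_deriv (inverse (U y)) = (U y * fps_deriv (inverse (U y))) * inverse (U y)"
    using inverse_mult_eq_1[of "U y"] by (simp add: mult_ac)
  fix V assume "V \<subseteq> X"
  hence V: "finite V" "\<forall>v\<in>V. m < v" using assms finite_subset by blast+
  hence "m \<notin> V" by auto
  have "(\<Sum>T\<in>Pow V. min_first_sum y m T * (fact (card (V - T)) * inverse (U y) $ card (V - T))) =
      avoiders_sum 1 y (insert m V)"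
    using avoiders_sum_insert_min[OF V, of 1 y] V(1) by (simp add: avoiders_sum_1)
  also have "\<dots> = fact (card V) * fps_deriv (inverse (U y)) $ card V"
    using V \<open>m \<notin> V\<close> by (simp add: avoiders_sum_1)
  finally show "(\<Sum>T\<in>Pow V. min_first_sum y m T * (fact (card (V - T)) * inverse (U y) $ card (V - T))) =
      fact (card V) * fps_deriv (inverse (U y)) $ card V" .
qed

section \<open>Powers with arbitrary exponent and the differential equation in
  \<open>x\<close>\<close>

lemma fps_gpower_0 [simp]: "fps_gpower F c $ 0 = 1"
  by (simp add: fps_gpower_def)

lemma fps_deriv_gpower:
  fixes F :: "'a::field_char_0 fps"
  assumes "F $ 0 = 1"
  shows "fps_deriv (fps_gpower F c) = fps_const c * (inverse F * fps_deriv F) * fps_gpower F c"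
proof -
  let ?L = "fps_ln 1 oo (F - 1)"
  have F0: "(F - 1) $ 0 = 0" using assms by simp
  have "fps_deriv ?L = (inverse (1 + fps_X) oo (F - 1)) * fps_deriv F"
    using F0 by (subst fps_compose_deriv) (simp_all add: fps_ln_deriv)
  also have "inverse (1 + fps_X) oo (F - 1) = inverse F"
    using F0 by (subst fps_inverse_compose) (simp_all add: fps_compose_add_distrib)
  finally have L: "fps_deriv ?L = inverse F * fps_deriv F" .
  have "(fps_const c * ?L) $ 0 = 0" by simp
  thus ?thesis unfolding fps_gpower_def
    by (subst fps_compose_deriv) (simp_all add: L mult_ac)
qed

text \<open>Both sides start with 1 and satisfy P' = x B P. The equation gives the value on
  \<open>X\<close> from the values on sets \<open>V - T\<close>, which are proper subsets because
  they miss the minimum.\<close>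

lemma avoiders_sum_eq_gpower:
  fixes x y :: "'b::field_char_0"
  assumes "finite X"
  shows "avoiders_sum x y X = fact (card X) * fps_gpower (inverse (U y)) x $ card X"
  using assms
proof (induction X rule: finite_psubset_induct)
  case (psubset X)
  show ?case
  proof (cases "X = {}")
    case True
    thus ?thesis by (simp add: avoiders_sum_def runs_def)
  next
    case False
    define m where "m = Min X"
    define V where "V = X - {m}"
    have "m \<in> X" using False psubset.hyps by (simp add: m_def)
    hence X: "X = insert m V" "m \<notin> V" "finite V" using psubset.hyps by (auto simp: V_def)
    have min: "\<forall>v\<in>V. m < v" using psubset.hyps by (auto simp: V_def m_def order.strict_iff_order)
    let ?P = "fps_gpower (inverse (U y)) x" and ?B = "U y * fps_deriv (inverse (U y))"
    have "avoiders_sum x y X = x * (\<Sum>T\<in>Pow V. min_first_sum y m T * avoiders_sum x y (V - T))"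
      unfolding X(1) by (rule avoiders_sum_insert_min[OF X(3) min])
    also have "(\<Sum>T\<in>Pow V. min_first_sum y m T * avoiders_sum x y (V - T)) =
       (\<Sum>T\<in>Pow V. (fact (card T) * ?B $ card T) * (fact (card (V - T)) * ?P $ card (V - T)))"
    proof (intro sum.cong refl)
      fix T assume "T \<in> Pow V"
      hence T: "finite T" "\<forall>v\<in>T. m < v" "V - T \<subset> X" using X min finite_subset by auto
      show "min_first_sum y m T * avoiders_sum x y (V - T) =
          (fact (card T) * ?B $ card T) * (fact (card (V - T)) * ?P $ card (V - T))"
        by (simp only: min_first_sum_eq[OF T(1,2)] psubset.IH[OF T(3)])
    qed
    also have "\<dots> = fact (card V) * (?B * ?P) $ card V"
      by (rule egf_mult[OF X(3)])
    \<comment> \<open>The logarithmic derivative of 1/U is U (1/U)', which is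
      \<open>?B\<close>.\<close>
    also have "x * \<dots> = fact (card V) * fps_deriv ?P $ card V"
      by (simp add: fps_deriv_gpower mult.assoc mult.left_commute[of x])
    also have "\<dots> = fact (card X) * ?P $ card X"
      using X by simp
    finally show ?thesis .
  qed
qed

theorem theorem8:
  fixes x y :: "'a::field_char_0"
  shows "NM {[1, 3, 2, 4], [1, 2, 3]} x y = fps_gpower (1 / U y) x"
proof (rule fps_ext)
  fix n
  have "avoiders {1..n} = NM_perms \<Gamma>\<^sub>0 n"
    by (simp add: avoiders_def NM_perms_def avoids_def)
  moreover have "runs \<sigma> = 1 + des \<sigma>" if "\<sigma> \<in> NM_perms \<Gamma>\<^sub>0 n" "n \<ge> 1" for \<sigma>
    using that by (auto simp: runs_def NM_perms_def permutations_of_set_def)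
  ultimately have "NM \<Gamma>\<^sub>0 x y $ n = avoiders_sum x y {1..n} / fact n" if "n \<ge> 1"
    using that by (simp add: NM_def avoiders_sum_def)
  moreover have "avoiders_sum x y {1..n} = fact n * fps_gpower (inverse (U y)) x $ n"
    using avoiders_sum_eq_gpower[of "{1..n}" x y] by simp
  ultimately show "NM \<Gamma>\<^sub>0 x y $ n = fps_gpower (1 / U y) x $ n"
    \<comment> \<open>For \<open>n = 0\<close> both constant terms are 1; division is inversion
      because \<open>U y $ 0 = 1\<close>.\<close>
    by (cases "n = 0") (simp_all add: NM_def fps_divide_unit)
qed

end
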